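(* Let $n\ge 1$ and let $\mathbf{A}\in\mathbb{C}^{n\times n}$ have Hermitian part $\mathbf{B}=(\mathbf{A}+\mathbf{A}^\dagger)/2$ and skew-Hermitian part $\mathbf{C}=(\mathbf{A}-\mathbf{A}^\dagger)/2$. If $x\in\mathbb{C}^n$ is a nontrivial fremdervector of $\mathbf{A}$, then the following three conditions hold. (i) $x$ is a fremdervector of $\mathbf{B}$. (ii) $x$ is a fremdervector of $\mathbf{C}$. (iii) At least one of $\mathbf{B}$ and $\mathbf{C}$ is indefinite.
   Context: $\langle\cdot,\cdot\rangle$ is the usual inner product on $\mathbb{C}^n$ and $\mathbf{A}^\dagger$ is the conjugate transpose of $\mathbf{A}$. For any $\mathbf{M}\in\mathbb{C}^{n\times n}$, a vector $x\in\mathbb{C}^n$ is a fremdervector of $\mathbf{M}$ if $\langle x,\mathbf{M}x\rangle=0$. A vector $x\in\ker(\mathbf{M})\cup\ker(\mathbf{M}^\dagger)$ is called a trivial fremdervector of $\mathbf{M}$; a nontrivial fremdervector of $\mathbf{M}$ is a fremdervector $x$ with $x\notin\ker(\mathbf{M})\cup\ker(\mathbf{M}^\dagger)$. A Hermitian matrix is indefinite if it has at least one positive and at least one negative eigenvalue. A skew-Hermitian matrix (whose eigenvalues are purely imaginary) is indefinite if it has at least one eigenvalue with positive imaginary part and at least one with negative imaginary part. *)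

theory Defs
  imports
    "Jordan_Normal_Form.Schur_Decomposition"
    "Jordan_Normal_Form.Matrix_Kernel"
begin

text \<open>The library's \<open>mat_adjoint\<close> is the conjugate transpose.\<close>

lemma mat_adjoint_entrywise:
  "mat_adjoint (A :: complex mat) = mat (dim_col A) (dim_row A) (\<lambda>(i, j). cnj (A $$ (j, i)))"
  by (intro eq_matI) (auto simp: mat_adjoint_def mat_of_rows_def)

definition hermitian :: "complex mat \<Rightarrow> bool" where
  "hermitian M \<longleftrightarrow> square_mat M \<and> mat_adjoint M = M"

definition skew_hermitian :: "complex mat \<Rightarrow> bool" where
  "skew_hermitian M \<longleftrightarrow> square_mat M \<and> mat_adjoint M = - M"

text \<open>The scalar product \<open>v \<bullet>c w\<close> is linear in \<open>v\<close> and conjugate-linear in \<open>w\<close>. With the opposite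
  convention the value below is replaced by its complex conjugate, so its vanishing does not depend
  on the choice.\<close>

definition fremdervector :: "complex mat \<Rightarrow> complex vec \<Rightarrow> bool" where
  "fremdervector M x \<longleftrightarrow> x \<in> carrier_vec (dim_col M) \<and> x \<bullet>c (M *\<^sub>v x) = 0"

definition trivial_fremdervector :: "complex mat \<Rightarrow> complex vec \<Rightarrow> bool" where
  "trivial_fremdervector M x \<longleftrightarrow> x \<in> mat_kernel M \<union> mat_kernel (mat_adjoint M)"

definition nontrivial_fremdervector :: "complex mat \<Rightarrow> complex vec \<Rightarrow> bool" where
  "nontrivial_fremdervector M x \<longleftrightarrow>
    fremdervector M x \<and> \<not> trivial_fremdervector M x"

definition hermitian_indefinite :: "complex mat \<Rightarrow> bool" where
  "hermitian_indefinite M \<longleftrightarrow> hermitian M \<and>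
    (\<exists>r::real. r > 0 \<and> eigenvalue M (complex_of_real r)) \<and>
    (\<exists>r::real. r < 0 \<and> eigenvalue M (complex_of_real r))"

definition skew_hermitian_indefinite :: "complex mat \<Rightarrow> bool" where
  "skew_hermitian_indefinite M \<longleftrightarrow> skew_hermitian M \<and>
    (\<exists>k. eigenvalue M k \<and> Im k > 0) \<and>
    (\<exists>k. eigenvalue M k \<and> Im k < 0)"

definition hermitian_part :: "complex mat \<Rightarrow> complex mat" where
  "hermitian_part A = (1 / 2) \<cdot>\<^sub>m (A + mat_adjoint A)"

definition skew_hermitian_part :: "complex mat \<Rightarrow> complex mat" where
  "skew_hermitian_part A = (1 / 2) \<cdot>\<^sub>m (A - mat_adjoint A)"

lemma hermitian_hermitian_part:
  assumes "A \<in> carrier_mat n n"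
  shows "hermitian (hermitian_part A)"
  using assms
  by (auto simp: hermitian_def hermitian_part_def mat_adjoint_entrywise intro!: eq_matI)

lemma skew_hermitian_skew_hermitian_part:
  assumes "A \<in> carrier_mat n n"
  shows "skew_hermitian (skew_hermitian_part A)"
  using assms
  by (auto simp: skew_hermitian_def skew_hermitian_part_def mat_adjoint_entrywise field_simps intro!: eq_matI)

end

theory Submission
  imports Defs
begin

text \<open>
  If \<open>x\<close> is isotropic for \<open>A\<close>, taking the complex conjugate shows that it is isotropic for
  \<open>mat_adjoint A\<close>, and therefore for both parts \<open>B\<close> and \<open>C\<close>. Since \<open>A = B + C\<close> and \<open>A x \<noteq> 0\<close>, at
  least one of \<open>B x\<close> and \<open>C x\<close> is nonzero. A semidefinite Hermitian matrix annihilates its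
  isotropic vectors, so a Hermitian matrix with an isotropic vector outside its kernel takes values
  of both signs, and has eigenvalues of both signs. For the skew-Hermitian part, the same is applied
  to \<open>\<i> C\<close> and \<open>- \<i> C\<close>.

  The passage from a negative value of the form to a negative eigenvalue does not diagonalise the
  matrix. It rests on the largest real \<open>m\<close> for which \<open>M - m I\<close> is positive semidefinite. If
  \<open>M - m I\<close> were invertible, its form would be bounded below by a positive multiple of the squared
  norm (\<open>invertible_psd_coercive\<close>), and \<open>m\<close> could be enlarged. So \<open>m\<close> is an eigenvalue, and it is
  negative as soon as the form takes a negative value (\<open>negative_eigenvalue_if_not_psd\<close>).

  Both uses of semidefiniteness, the one for isotropic vectors and the one for coercivity, come from
  the single inequality \<open>\<parallel>N u\<parallel>\<^sup>2 \<le> c \<langle>u, N u\<rangle>\<close> for positive semidefinite \<open>N\<close>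
  (\<open>psd_norm2_le_quadratic_form\<close>).
\<close>

section \<open>The standard scalar product on complex vectors\<close>


lemma cscalar_prod_mult_mat_vec:
  fixes M :: "complex mat"
  assumes "M \<in> carrier_mat nr nc" "u \<in> carrier_vec nc" "w \<in> carrier_vec nr"
  shows "(M *\<^sub>v u) \<bullet>c w = u \<bullet>c (mat_adjoint M *\<^sub>v w)"
proof -
  have "(M *\<^sub>v u) \<bullet>c w = (\<Sum>i<nr. \<Sum>j<nc. M $$ (i,j) * u $ j * cnj (w $ i))"
    using assms by (auto simp: scalar_prod_def sum_distrib_right lessThan_atLeast0 intro!: sum.cong)
  also have "\<dots> = (\<Sum>j<nc. \<Sum>i<nr. M $$ (i,j) * u $ j * cnj (w $ i))"
    by (rule sum.swap)
  also have "\<dots> = u \<bullet>c (mat_adjoint M *\<^sub>v w)"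
    using assms
    by (auto simp: scalar_prod_def mat_adjoint_entrywise lessThan_atLeast0 sum_distrib_left
        intro!: sum.cong)
  finally show ?thesis .
qed

lemma cscalar_prod_commute:
  fixes v w :: "complex vec"
  assumes "v \<in> carrier_vec n" "w \<in> carrier_vec n"
  shows "w \<bullet>c v = cnj (v \<bullet>c w)"
  using assms by (auto simp: scalar_prod_def mult.commute intro!: sum.cong)

lemma cscalar_prod_self_eq: "v \<bullet>c v = complex_of_real (\<Sum>i<dim_vec v. (cmod (v $ i))\<^sup>2)"
  for v :: "complex vec"
  by (simp add: scalar_prod_def lessThan_atLeast0 complex_norm_square del: of_real_power)

lemma smult_mat_mult_vec:
  fixes M :: "'a :: comm_ring_1 mat"
  assumes "M \<in> carrier_mat nr nc" "v \<in> carrier_vec nc"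
  shows "(a \<cdot>\<^sub>m M) *\<^sub>v v = a \<cdot>\<^sub>v (M *\<^sub>v v)"
  using assms by (auto simp: vec_eq_iff)

section \<open>Quadratic forms\<close>

text \<open>For Hermitian \<open>M\<close> the scalar product is already real; the real part serves to compare
  values in the order of the reals.\<close>

definition quadratic_form :: "complex mat \<Rightarrow> complex vec \<Rightarrow> real" where
  "quadratic_form M v = Re (v \<bullet>c (M *\<^sub>v v))"

abbreviation norm2 :: "complex vec \<Rightarrow> real" where
  "norm2 v \<equiv> Re (v \<bullet>c v)"

lemma norm2_nonneg: "norm2 v \<ge> 0"
  by (simp add: cscalar_prod_self_eq sum_nonneg)

lemma norm2_eq_0_iff:
  assumes "v \<in> carrier_vec n"
  shows "norm2 v = 0 \<longleftrightarrow> v = 0\<^sub>v n"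
proof -
  have "norm2 v = 0 \<longleftrightarrow> v \<bullet>c v = 0"
    by (simp only: cscalar_prod_self_eq of_real_eq_0_iff Re_complex_of_real)
  then show ?thesis using assms by simp
qed

text \<open>A crude bound suffices: each product of two entries of \<open>v\<close> has modulus at most
  \<open>norm2 v\<close>, so the sum of the moduli of the entries of \<open>K\<close> serves as constant. The added 1 makes
  the constant positive even for the zero matrix.\<close>

lemma quadratic_form_bound:
  assumes K: "K \<in> carrier_mat n n"
  obtains c where "c > 0" "\<And>v. v \<in> carrier_vec n \<Longrightarrow> \<bar>quadratic_form K v\<bar> \<le> c * norm2 v"
proof
  define c where "c = 1 + (\<Sum>i<n. \<Sum>j<n. cmod (K $$ (i,j)))"
  show "c > 0" unfolding c_def by (intro add_pos_nonneg sum_nonneg) auto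
  fix v :: "complex vec" assume v: "v \<in> carrier_vec n"
  have entry: "(cmod (v $ i))\<^sup>2 \<le> norm2 v" if "i < n" for i
    using v that by (auto simp: cscalar_prod_self_eq intro!: member_le_sum)
  have prod: "cmod (v $ i) * cmod (v $ j) \<le> norm2 v" if "i < n" "j < n" for i j
    using entry[OF that(1)] entry[OF that(2)] sum_squares_bound[of "cmod (v $ i)" "cmod (v $ j)"]
    by simp
  have "v \<bullet>c (K *\<^sub>v v) = (\<Sum>i<n. \<Sum>j<n. v $ i * cnj (K $$ (i,j) * v $ j))"
    using K v by (auto simp: scalar_prod_def lessThan_atLeast0 sum_distrib_left intro!: sum.cong)
  then have "\<bar>quadratic_form K v\<bar> \<le> cmod (\<Sum>i<n. \<Sum>j<n. v $ i * cnj (K $$ (i,j) * v $ j))"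
    unfolding quadratic_form_def by (metis abs_Re_le_cmod)
  also have "\<dots> \<le> (\<Sum>i<n. \<Sum>j<n. cmod (v $ i * cnj (K $$ (i,j) * v $ j)))"
    by (intro order_trans[OF norm_sum] sum_mono norm_sum)
  also have "\<dots> = (\<Sum>i<n. \<Sum>j<n. cmod (K $$ (i,j)) * (cmod (v $ i) * cmod (v $ j)))"
    by (simp add: norm_mult mult_ac)
  also have "\<dots> \<le> (\<Sum>i<n. \<Sum>j<n. cmod (K $$ (i,j)) * norm2 v)"
    by (intro sum_mono mult_left_mono prod) auto
  also have "\<dots> \<le> c * norm2 v"
    using norm2_nonneg[of v] by (simp add: c_def sum_distrib_right distrib_right)
  finally show "\<bar>quadratic_form K v\<bar> \<le> c * norm2 v" .
qed

text \<open>The form is nonnegative at \<open>u - t N u\<close> for every real \<open>t\<close>. Expanding it there gives a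
  quadratic polynomial in \<open>t\<close> with linear term \<open>- 2 t \<parallel>N u\<parallel>\<^sup>2\<close> and quadratic term at most
  \<open>c t\<^sup>2 \<parallel>N u\<parallel>\<^sup>2\<close>, where \<open>c\<close> bounds the form of \<open>N\<close>. The choice \<open>t = 1 / c\<close> minimises this
  bound and yields the claim.\<close>

lemma psd_norm2_le_quadratic_form:
  assumes N: "N \<in> carrier_mat n n" "hermitian N"
    and psd: "\<And>v. v \<in> carrier_vec n \<Longrightarrow> quadratic_form N v \<ge> 0"
  obtains c where "c > 0" "\<And>u. u \<in> carrier_vec n \<Longrightarrow> norm2 (N *\<^sub>v u) \<le> c * quadratic_form N u"
proof -
  obtain c where c: "c > 0"
    and bound: "\<And>v. v \<in> carrier_vec n \<Longrightarrow> \<bar>quadratic_form N v\<bar> \<le> c * norm2 v"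
    using quadratic_form_bound[OF N(1)] by blast
  have "norm2 (N *\<^sub>v u) \<le> c * quadratic_form N u" if u: "u \<in> carrier_vec n" for u
  proof -
    define w where "w = N *\<^sub>v u"
    define t where "t = complex_of_real (1 / c)"
    have w: "w \<in> carrier_vec n" and Nw: "N *\<^sub>v w \<in> carrier_vec n"
      using N(1) u by (auto simp: w_def)
    have uNw: "u \<bullet>c (N *\<^sub>v w) = w \<bullet>c w"
      using cscalar_prod_mult_mat_vec[OF N(1) u w] N(2) by (simp add: hermitian_def w_def)
    have cnj_t: "cnj t = t" by (simp add: t_def)
    have "(u + (- t) \<cdot>\<^sub>v w) \<bullet>c (N *\<^sub>v (u + (- t) \<cdot>\<^sub>v w))
        = (u + (- t) \<cdot>\<^sub>v w) \<bullet> (conjugate w + (- t) \<cdot>\<^sub>v conjugate (N *\<^sub>v w))"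
      using N(1) u w Nw
      by (simp add: mult_add_distrib_mat_vec[of _ n n] mult_mat_vec[of _ n n] conjugate_add_vec[of _ n]
          conjugate_smult_vec cnj_t flip: w_def)
    also have "\<dots> = u \<bullet>c w - t * (w \<bullet>c w) - t * (u \<bullet>c (N *\<^sub>v w)) + t * t * (w \<bullet>c (N *\<^sub>v w))"
      using u w Nw
      by (simp add: add_scalar_prod_distrib[of _ n] scalar_prod_add_distrib[of _ n] algebra_simps)
    also have "\<dots> = u \<bullet>c w - 2 * t * (w \<bullet>c w) + t * t * (w \<bullet>c (N *\<^sub>v w))"
      by (simp add: uNw)
    finally have "quadratic_form N (u + (- t) \<cdot>\<^sub>v w)
        = quadratic_form N u - 2 / c * norm2 w + (1 / c) * (1 / c) * quadratic_form N w"
      unfolding quadratic_form_def t_def w_def[symmetric]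
      by (simp del: of_real_divide flip: of_real_mult)
    moreover have "quadratic_form N (u + (- t) \<cdot>\<^sub>v w) \<ge> 0"
      using u w by (intro psd) auto
    moreover have "(1 / c) * (1 / c) * quadratic_form N w \<le> (1 / c) * (1 / c) * (c * norm2 w)"
      using bound[OF w] c by (intro mult_left_mono) auto
    moreover have "(1 / c) * (1 / c) * (c * norm2 w) = norm2 w / c" "2 / c * norm2 w = 2 * (norm2 w / c)"
      using c by (simp_all add: field_simps)
    ultimately have "norm2 w / c \<le> quadratic_form N u"
      by linarith
    then show ?thesis using c by (simp add: field_simps w_def)
  qed
  then show thesis using that c by blast
qed

section \<open>Negative eigenvalues of Hermitian matrices\<close>

lemma char_matrix_quadratic_form:
  assumes M: "M \<in> carrier_mat n n" and v: "v \<in> carrier_vec n"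
  shows "quadratic_form (char_matrix M (complex_of_real s)) v = quadratic_form M v - s * norm2 v"
proof -
  have "char_matrix M (complex_of_real s) *\<^sub>v v = M *\<^sub>v v + complex_of_real (- s) \<cdot>\<^sub>v v"
    using M v
    by (simp add: char_matrix_def add_mult_distrib_mat_vec[of _ n n] smult_mat_mult_vec[of _ n n])
  then show ?thesis
    using M v unfolding quadratic_form_def
    by (simp add: conjugate_add_vec[of _ n] conjugate_smult_vec scalar_prod_add_distrib[of _ n])
qed

lemma hermitian_char_matrix:
  assumes "M \<in> carrier_mat n n" "hermitian M"
  shows "hermitian (char_matrix M (complex_of_real s))"
proof -
  have adj: "cnj (M $$ (j,i)) = M $$ (i,j)" if "i < n" "j < n" for i j
  proof -
    have "mat_adjoint M $$ (i,j) = M $$ (i,j)" using assms by (simp add: hermitian_def)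
    then show ?thesis using assms(1) that by (simp add: mat_adjoint_entrywise)
  qed
  then show ?thesis
    using assms(1) unfolding hermitian_def
    by (auto simp: char_matrix_def mat_adjoint_entrywise intro!: eq_matI)
qed

text \<open>Applying the inverse \<open>K\<close> to \<open>N v\<close> recovers \<open>v\<close>, so \<open>\<parallel>v\<parallel>\<^sup>2 \<le> a \<parallel>N v\<parallel>\<^sup>2\<close> with a bound \<open>a\<close>
  for the form of \<open>mat_adjoint K * K\<close>; and \<open>\<parallel>N v\<parallel>\<^sup>2\<close> is controlled by the form of \<open>N\<close>.\<close>

lemma invertible_psd_coercive:
  assumes N: "N \<in> carrier_mat n n" "hermitian N" "det N \<noteq> 0"
    and psd: "\<And>v. v \<in> carrier_vec n \<Longrightarrow> quadratic_form N v \<ge> 0"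
  obtains d where "d > 0" "\<And>v. v \<in> carrier_vec n \<Longrightarrow> d * norm2 v \<le> quadratic_form N v"
proof -
  obtain K where K: "K \<in> carrier_mat n n" and KN: "K * N = 1\<^sub>m n"
    using det_non_zero_imp_unit[OF N(1,3), of "()"] by (auto simp: Units_def ring_mat_def)
  define L where "L = mat_adjoint K * K"
  have aK: "mat_adjoint K \<in> carrier_mat n n" using K by (simp add: mat_adjoint_entrywise)
  then have L: "L \<in> carrier_mat n n" using K by (simp add: L_def)
  obtain a where a: "a > 0"
    and boundL: "\<And>v. v \<in> carrier_vec n \<Longrightarrow> \<bar>quadratic_form L v\<bar> \<le> a * norm2 v"
    using quadratic_form_bound[OF L] by blast
  obtain c where c: "c > 0"
    and boundN: "\<And>v. v \<in> carrier_vec n \<Longrightarrow> norm2 (N *\<^sub>v v) \<le> c * quadratic_form N v"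
    using psd_norm2_le_quadratic_form[OF N(1,2) psd] by blast
  have "1 / (a * c) * norm2 v \<le> quadratic_form N v" if v: "v \<in> carrier_vec n" for v
  proof -
    have Nv: "N *\<^sub>v v \<in> carrier_vec n" using N(1) v by simp
    have KNv: "K *\<^sub>v (N *\<^sub>v v) = v"
      using assoc_mult_mat_vec[OF K N(1) v] v by (simp add: KN)
    have "norm2 v = quadratic_form L (N *\<^sub>v v)"
      using cscalar_prod_mult_mat_vec[OF K Nv v] aK K Nv
      by (simp add: quadratic_form_def L_def KNv)
    also have "\<dots> \<le> a * norm2 (N *\<^sub>v v)" using boundL[OF Nv] by simp
    also have "\<dots> \<le> a * (c * quadratic_form N v)"
      using boundN[OF v] a by (intro mult_left_mono) auto
    finally show ?thesis using a c by (simp add: field_simps)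
  qed
  then show thesis using that[of "1 / (a * c)"] a c by simp
qed

text \<open>The eigenvalue found is the least one, obtained as the supremum \<open>m\<close> of all \<open>s\<close> such that
  \<open>M - s I\<close> is positive semidefinite. The Rayleigh quotient of \<open>u\<close> bounds \<open>m\<close> from above and is
  negative, and \<open>M - m I\<close> is singular because \<open>m\<close> cannot be enlarged.\<close>

lemma negative_eigenvalue_if_not_psd:
  assumes M: "M \<in> carrier_mat n n" "hermitian M"
    and u: "u \<in> carrier_vec n" "quadratic_form M u < 0"
  shows "\<exists>r<0. eigenvalue M (complex_of_real r)"
proof -
  define S where "S = {s. \<forall>v \<in> carrier_vec n. s * norm2 v \<le> quadratic_form M v}"
  have u_pos: "norm2 u > 0"
  proof -
    have "u \<noteq> 0\<^sub>v n" using u(2) M(1) by (auto simp: quadratic_form_def)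
    then show ?thesis using norm2_eq_0_iff[OF u(1)] norm2_nonneg[of u] by linarith
  qed
  obtain c where c: "\<And>v. v \<in> carrier_vec n \<Longrightarrow> \<bar>quadratic_form M v\<bar> \<le> c * norm2 v"
    using quadratic_form_bound[OF M(1)] by blast
  have "- c \<in> S"
    unfolding S_def using c by force
  have upper: "s \<le> quadratic_form M u / norm2 u" if "s \<in> S" for s
    using that u(1) u_pos by (auto simp: S_def pos_le_divide_eq)
  then have bdd: "bdd_above S" by (auto simp: bdd_above_def)
  define m where "m = Sup S"
  have "m \<le> quadratic_form M u / norm2 u"
    unfolding m_def using \<open>- c \<in> S\<close> upper by (intro cSup_least) auto
  then have "m < 0" using u(2) u_pos by (meson divide_neg_pos order_le_less_trans)
  (* The supremum is attained: it lies below every Rayleigh quotient. *)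
  have m_S: "m * norm2 v \<le> quadratic_form M v" if v: "v \<in> carrier_vec n" for v
  proof (cases "norm2 v = 0")
    case True
    then show ?thesis using c[OF v] by simp
  next
    case False
    then have pos: "norm2 v > 0" using norm2_nonneg[of v] by simp
    have "m \<le> quadratic_form M v / norm2 v"
      unfolding m_def
    proof (rule cSup_least)
      show "S \<noteq> {}" using \<open>- c \<in> S\<close> by blast
    qed (use v pos in \<open>auto simp: S_def pos_le_divide_eq\<close>)
    then show ?thesis using pos by (simp add: pos_le_divide_eq)
  qed
  define N where "N = char_matrix M (complex_of_real m)"
  have N: "N \<in> carrier_mat n n" "hermitian N"
    using M hermitian_char_matrix by (auto simp: N_def)
  have N_form: "quadratic_form N v = quadratic_form M v - m * norm2 v" if "v \<in> carrier_vec n" for v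
    unfolding N_def by (rule char_matrix_quadratic_form[OF M(1) that])
  have "det N = 0"
  proof (rule ccontr)
    assume "det N \<noteq> 0"
    then obtain d where "d > 0" and d: "\<And>v. v \<in> carrier_vec n \<Longrightarrow> d * norm2 v \<le> quadratic_form N v"
      using invertible_psd_coercive[OF N] N_form m_S by (metis diff_ge_0_iff_ge)
    have "m + d \<in> S"
      using d N_form by (force simp: S_def algebra_simps)
    then have "m + d \<le> m" unfolding m_def using bdd by (rule cSup_upper)
    then show False using \<open>d > 0\<close> by simp
  qed
  then show ?thesis
    using \<open>m < 0\<close> eigenvalue_det[OF M(1)] by (auto simp: N_def)
qed

section \<open>Isotropic vectors and indefiniteness\<close>

text \<open>Without negative eigenvalues the form would be positive semidefinite, and then \<open>\<parallel>M x\<parallel>\<^sup>2\<close>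
  would be at most a multiple of the value of the form at \<open>x\<close>, which is zero.\<close>

lemma negative_eigenvalue_if_isotropic:
  assumes M: "M \<in> carrier_mat n n" "hermitian M"
    and x: "x \<in> carrier_vec n" "x \<bullet>c (M *\<^sub>v x) = 0" "M *\<^sub>v x \<noteq> 0\<^sub>v n"
  shows "\<exists>r<0. eigenvalue M (complex_of_real r)"
proof (rule ccontr)
  assume "\<not> ?thesis"
  then have "quadratic_form M v \<ge> 0" if "v \<in> carrier_vec n" for v
    using negative_eigenvalue_if_not_psd[OF M that] by force
  then obtain c where "norm2 (M *\<^sub>v x) \<le> c * quadratic_form M x"
    using psd_norm2_le_quadratic_form[OF M] x(1) by metis
  then have "norm2 (M *\<^sub>v x) = 0"
    using x(2) norm2_nonneg[of "M *\<^sub>v x"] by (simp add: quadratic_form_def)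
  then show False
    using norm2_eq_0_iff[of "M *\<^sub>v x" n] M(1) x(1,3) by simp
qed

lemma eigenvalue_smult_mat:
  fixes M :: "'a :: field mat"
  assumes M: "M \<in> carrier_mat n n" and a: "a \<noteq> 0" and "eigenvalue (a \<cdot>\<^sub>m M) k"
  shows "eigenvalue M (k / a)"
proof -
  obtain v where v: "v \<in> carrier_vec n" "v \<noteq> 0\<^sub>v n" "(a \<cdot>\<^sub>m M) *\<^sub>v v = k \<cdot>\<^sub>v v"
    using assms by (auto simp: eigenvalue_def eigenvector_def)
  have "a \<cdot>\<^sub>v (M *\<^sub>v v) = k \<cdot>\<^sub>v v"
    using smult_mat_mult_vec[OF M v(1)] v(3) by simp
  then have "(1 / a) \<cdot>\<^sub>v (a \<cdot>\<^sub>v (M *\<^sub>v v)) = (1 / a) \<cdot>\<^sub>v (k \<cdot>\<^sub>v v)" by simp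
  then have "M *\<^sub>v v = (k / a) \<cdot>\<^sub>v v" using a by (simp add: smult_smult_assoc)
  then show ?thesis using M v by (auto simp: eigenvalue_def eigenvector_def)
qed

text \<open>Scaling \<open>M\<close> by \<open>a\<close> changes neither which vectors are isotropic nor the kernel. The values
  \<open>a = - 1\<close>, \<open>a = \<i>\<close> and \<open>a = - \<i>\<close> turn the existence of a negative eigenvalue into that of an
  eigenvalue in the other directions that indefiniteness asks for.\<close>

lemma eigenvalue_of_smult_isotropic:
  assumes M: "M \<in> carrier_mat n n" and a: "a \<noteq> 0" "hermitian (a \<cdot>\<^sub>m M)"
    and x: "x \<in> carrier_vec n" "x \<bullet>c (M *\<^sub>v x) = 0" "M *\<^sub>v x \<noteq> 0\<^sub>v n"
  shows "\<exists>r<0. eigenvalue M (complex_of_real r / a)"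
proof -
  have aMx: "(a \<cdot>\<^sub>m M) *\<^sub>v x = a \<cdot>\<^sub>v (M *\<^sub>v x)"
    by (rule smult_mat_mult_vec[OF M x(1)])
  have "x \<bullet>c ((a \<cdot>\<^sub>m M) *\<^sub>v x) = 0"
    unfolding aMx using M x(1,2) by (simp add: conjugate_smult_vec)
  moreover have "(a \<cdot>\<^sub>m M) *\<^sub>v x \<noteq> 0\<^sub>v n"
    unfolding aMx using M a(1) x(1,3) by (auto simp: vec_eq_iff)
  ultimately show ?thesis
    using negative_eigenvalue_if_isotropic[of "a \<cdot>\<^sub>m M" n x] eigenvalue_smult_mat[OF M a(1)] M a x(1)
    by (metis smult_carrier_mat)
qed

lemma hermitian_smult_real:
  assumes "hermitian M" "cnj a = a"
  shows "hermitian (a \<cdot>\<^sub>m M)"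
proof -
  have "mat_adjoint (a \<cdot>\<^sub>m M) = cnj a \<cdot>\<^sub>m mat_adjoint M"
    by (auto simp: mat_adjoint_entrywise intro!: eq_matI)
  then show ?thesis using assms by (simp add: hermitian_def)
qed

lemma hermitian_smult_imaginary:
  assumes "skew_hermitian M" "cnj a = - a"
  shows "hermitian (a \<cdot>\<^sub>m M)"
proof -
  have "mat_adjoint (a \<cdot>\<^sub>m M) = cnj a \<cdot>\<^sub>m mat_adjoint M"
    by (auto simp: mat_adjoint_entrywise intro!: eq_matI)
  also have "\<dots> = a \<cdot>\<^sub>m M"
    using assms by (auto simp: skew_hermitian_def intro!: eq_matI)
  finally show ?thesis using assms by (simp add: hermitian_def skew_hermitian_def)
qed

lemma hermitian_indefinite_if_isotropic:
  assumes M: "M \<in> carrier_mat n n" "hermitian M"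
    and x: "x \<in> carrier_vec n" "x \<bullet>c (M *\<^sub>v x) = 0" "M *\<^sub>v x \<noteq> 0\<^sub>v n"
  shows "hermitian_indefinite M"
proof -
  obtain r where "r < 0" "eigenvalue M (complex_of_real r)"
    using negative_eigenvalue_if_isotropic[OF M x] by blast
  moreover obtain s where "s < 0" "eigenvalue M (complex_of_real s / (- 1))"
    using eigenvalue_of_smult_isotropic[OF M(1) _ hermitian_smult_real[OF M(2)] x, of "- 1"] by auto
  then have "- s > 0 \<and> eigenvalue M (complex_of_real (- s))" by simp
  ultimately show ?thesis unfolding hermitian_indefinite_def using M(2) by blast
qed

lemma skew_hermitian_indefinite_if_isotropic:
  assumes M: "M \<in> carrier_mat n n" "skew_hermitian M"
    and x: "x \<in> carrier_vec n" "x \<bullet>c (M *\<^sub>v x) = 0" "M *\<^sub>v x \<noteq> 0\<^sub>v n"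
  shows "skew_hermitian_indefinite M"
proof -
  obtain r where "r < 0" "eigenvalue M (complex_of_real r / \<i>)"
    using eigenvalue_of_smult_isotropic[OF M(1) _ hermitian_smult_imaginary[OF M(2)] x, of "\<i>"]
    by auto
  moreover obtain s where "s < 0" "eigenvalue M (complex_of_real s / (- \<i>))"
    using eigenvalue_of_smult_isotropic[OF M(1) _ hermitian_smult_imaginary[OF M(2)] x, of "- \<i>"]
    by auto
  moreover have "Im (complex_of_real r / \<i>) = - r" "Im (complex_of_real s / (- \<i>)) = s"
    by (simp_all add: complex_eq_iff Im_divide)
  ultimately show ?thesis
    unfolding skew_hermitian_indefinite_def using M(2) by (metis neg_0_less_iff_less)
qed

theorem theorem4p5:
  fixes n :: nat and A B C :: "complex mat" and x :: "complex vec"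
  assumes "n \<ge> 1"
    and "A \<in> carrier_mat n n"
    and "B = hermitian_part A"
    and "C = skew_hermitian_part A"
    and "x \<in> carrier_vec n"
    and "nontrivial_fremdervector A x"
  shows "fremdervector B x \<and>
         fremdervector C x \<and>
         (hermitian_indefinite B \<or> skew_hermitian_indefinite C)"
proof -
  note A = assms(2) and x = assms(5)
  define A' where "A' = mat_adjoint A"
  have A': "A' \<in> carrier_mat n n" using A by (simp add: A'_def mat_adjoint_entrywise)
  have Ax: "A *\<^sub>v x \<in> carrier_vec n" and A'x: "A' *\<^sub>v x \<in> carrier_vec n"
    using A A' x by auto
  have B: "B \<in> carrier_mat n n" "hermitian B" and C: "C \<in> carrier_mat n n" "skew_hermitian C"
    using A A' assms(3,4) hermitian_hermitian_part[OF A] skew_hermitian_skew_hermitian_part[OF A]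
    by (auto simp: hermitian_part_def skew_hermitian_part_def simp flip: A'_def)
  have iso: "x \<bullet>c (A *\<^sub>v x) = 0"
    using assms(6) by (simp add: nontrivial_fremdervector_def fremdervector_def)
  have "x \<bullet>c (A' *\<^sub>v x) = cnj (x \<bullet>c (A *\<^sub>v x))"
    using cscalar_prod_mult_mat_vec[OF A x x] cscalar_prod_commute[OF x Ax] by (simp add: A'_def)
  then have iso': "x \<bullet>c (A' *\<^sub>v x) = 0" by (simp add: iso)
  have Bx: "B *\<^sub>v x = (1 / 2) \<cdot>\<^sub>v (A *\<^sub>v x + A' *\<^sub>v x)"
    using A A' x
    by (simp add: assms(3) hermitian_part_def smult_mat_mult_vec[of _ n n]
        add_mult_distrib_mat_vec[of _ n n] flip: A'_def)
  have Cx: "C *\<^sub>v x = (1 / 2) \<cdot>\<^sub>v (A *\<^sub>v x - A' *\<^sub>v x)"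
    using A A' x
    by (simp add: assms(4) skew_hermitian_part_def smult_mat_mult_vec[of _ n n]
        minus_mult_distrib_mat_vec[of _ n n] minus_carrier_mat flip: A'_def)
  have isoB: "x \<bullet>c (B *\<^sub>v x) = 0"
    using x Ax A'x iso iso'
    by (simp add: Bx conjugate_smult_vec conjugate_add_vec[of _ n] scalar_prod_add_distrib[of _ n])
  have "conjugate (A *\<^sub>v x - A' *\<^sub>v x) = conjugate (A *\<^sub>v x) - conjugate (A' *\<^sub>v x)"
    using A A' by (auto simp: vec_eq_iff)
  then have isoC: "x \<bullet>c (C *\<^sub>v x) = 0"
    using x Ax A'x iso iso' 
    by (simp add: Cx conjugate_smult_vec scalar_prod_minus_distrib[of _ n])
  have "B *\<^sub>v x \<noteq> 0\<^sub>v n \<or> C *\<^sub>v x \<noteq> 0\<^sub>v n"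
  proof (rule ccontr)
    assume "\<not> ?thesis"
    moreover have "A *\<^sub>v x = B *\<^sub>v x + C *\<^sub>v x"
      unfolding Bx Cx using A A' by (auto simp: vec_eq_iff field_simps)
    ultimately have "A *\<^sub>v x = 0\<^sub>v n" by simp
    then have "x \<in> mat_kernel A" using A x by (intro mat_kernelI)
    then show False
      using assms(6) by (simp add: nontrivial_fremdervector_def trivial_fremdervector_def)
  qed
  then have "hermitian_indefinite B \<or> skew_hermitian_indefinite C"
    using hermitian_indefinite_if_isotropic[OF B x isoB]
      skew_hermitian_indefinite_if_isotropic[OF C x isoC] by blast
  then show ?thesis
    using B(1) C(1) x isoB isoC by (simp add: fremdervector_def)
qed

end
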